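(* For each $n$ let $(X_1,Y_1),\dots,(X_n,Y_n)$ be i.i.d. with $Y_i=\beta^TX_i+\epsilon_i$, $\beta\in\mathbb{R}^p$, $E(\epsilon_i\mid X_i)=0$, $E(\epsilon_i^2\mid X_i)=\sigma^2$. Assume $X_i\overset{i.i.d.}{\sim}N(\mathbf{0},\mathbf{I})$ in $\mathbb{R}^p$ and $\epsilon_1,\dots,\epsilon_n\sim N(0,\sigma^2)$. Let $\tau^2=\|\beta\|^2$. If, as $n,p\to\infty$, $\tau^2+\sigma^2$ is bounded and $p/n$ converges to a constant, then $$\sqrt n\,\bigl(\hat\tau^2-\hat\tau^2_{Dicker}\bigr)\overset{p}{\rightarrow}0 .$$
   Context: Asymptotics: $n$ and $p=p_n$ go to infinity together; $\beta$ and $\sigma^2$ may depend on $n$. $W_{ij}=X_{ij}Y_i$, and the naive estimator is $\hat\tau^2=\frac{1}{n(n-1)}\sum_{j=1}^p\sum_{i_1\ne i_2}W_{i_1j}W_{i_2j}$. $\hat\tau^2_{Dicker}=\dfrac{\|\mathbf{X}^T\mathbf{Y}\|^2-p\|\mathbf{Y}\|^2}{n(n+1)}$, where $\mathbf{X}$ is the $n\times p$ design matrix with rows $X_i^T$ and $\mathbf{Y}=(Y_1,\dots,Y_n)^T$. $\overset{p}{\rightarrow}$ denotes convergence in probability. *)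

theory Defs
  imports "HOL-Probability.Probability"
begin

text \<open>
  A vector of dimension \<open>p\<close> is a function on the indices \<open>{..<p}\<close>, and the Borel space of
  such vectors is \<open>PiM {..<p} (\<lambda>_. borel)\<close>. Observations are indexed by \<open>{..<n}\<close>.
\<close>

abbreviation vec_borel :: "nat \<Rightarrow> (nat \<Rightarrow> real) measure" where
  "vec_borel p \<equiv> PiM {..<p} (\<lambda>_. borel)"

definition sq_norm :: "nat \<Rightarrow> (nat \<Rightarrow> real) \<Rightarrow> real" where
  "sq_norm p v = (\<Sum>j<p. (v j)\<^sup>2)"

definition normal_dist :: "real \<Rightarrow> real \<Rightarrow> real measure" where
  "normal_dist \<mu> \<sigma> =
     (if \<sigma> = 0 then return borel \<mu> else density lborel (normal_density \<mu> \<sigma>))"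

text \<open>The distribution \<open>N(0, I)\<close> on vectors of dimension \<open>p\<close>.\<close>

definition std_normal_vec :: "nat \<Rightarrow> (nat \<Rightarrow> real) measure" where
  "std_normal_vec p = PiM {..<p} (\<lambda>_. std_normal_distribution)"

text \<open>
  The conditional moment assumptions do not make the errors independent of the covariates;
  only the pairs \<open>(X i, Y i)\<close> are independent of each other.
  The integrability assumption is needed because \<open>real_cond_exp\<close> is total.
\<close>

locale linear_model = prob_space M
  for M :: "'a measure" +
  fixes n p :: nat and \<beta> :: "nat \<Rightarrow> real" and \<sigma> :: real
    and X :: "nat \<Rightarrow> 'a \<Rightarrow> nat \<Rightarrow> real" and Y \<epsilon> :: "nat \<Rightarrow> 'a \<Rightarrow> real"
  assumes indep_pairs:
      "indep_vars (\<lambda>_. vec_borel p \<Otimes>\<^sub>M borel) (\<lambda>i \<omega>. (X i \<omega>, Y i \<omega>)) {..<n}"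
    and ident_pairs:
      "\<And>i k. i < n \<Longrightarrow> k < n \<Longrightarrow>
         distr M (vec_borel p \<Otimes>\<^sub>M borel) (\<lambda>\<omega>. (X i \<omega>, Y i \<omega>)) =
         distr M (vec_borel p \<Otimes>\<^sub>M borel) (\<lambda>\<omega>. (X k \<omega>, Y k \<omega>))"
    and response:
      "\<And>i \<omega>. i < n \<Longrightarrow> \<omega> \<in> space M \<Longrightarrow> Y i \<omega> = (\<Sum>j<p. \<beta> j * X i \<omega> j) + \<epsilon> i \<omega>"
    and sigma_nonneg: "0 \<le> \<sigma>"
    and error_sq_integrable: "\<And>i. i < n \<Longrightarrow> integrable M (\<lambda>\<omega>. (\<epsilon> i \<omega>)\<^sup>2)"
    and error_cond_mean:
      "\<And>i. i < n \<Longrightarrow>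
         AE \<omega> in M. real_cond_exp M (vimage_algebra (space M) (X i) (vec_borel p)) (\<epsilon> i) \<omega> = 0"
    and error_cond_var:
      "\<And>i. i < n \<Longrightarrow>
         AE \<omega> in M. real_cond_exp M (vimage_algebra (space M) (X i) (vec_borel p))
                      (\<lambda>\<omega>. (\<epsilon> i \<omega>)\<^sup>2) \<omega> = \<sigma>\<^sup>2"

locale gaussian_linear_model = linear_model +
  assumes X_normal: "\<And>i. i < n \<Longrightarrow> distr M (vec_borel p) (X i) = std_normal_vec p"
    and error_normal: "\<And>i. i < n \<Longrightarrow> distr M borel (\<epsilon> i) = normal_dist 0 \<sigma>"

text \<open>
  The estimators are functions of the data: \<open>x i\<close> is the \<open>i\<close>-th row of the design matrix and
  \<open>y i\<close> the \<open>i\<close>-th response.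
\<close>

definition W :: "(nat \<Rightarrow> nat \<Rightarrow> real) \<Rightarrow> (nat \<Rightarrow> real) \<Rightarrow> nat \<Rightarrow> nat \<Rightarrow> real" where
  "W x y i j = x i j * y i"

definition naive_estimator ::
    "nat \<Rightarrow> nat \<Rightarrow> (nat \<Rightarrow> nat \<Rightarrow> real) \<Rightarrow> (nat \<Rightarrow> real) \<Rightarrow> real" where
  "naive_estimator n p x y =
     1 / (real n * (real n - 1)) *
     (\<Sum>j<p. \<Sum>i\<^sub>1<n. \<Sum>i\<^sub>2\<in>{..<n} - {i\<^sub>1}. W x y i\<^sub>1 j * W x y i\<^sub>2 j)"

definition dicker_estimator ::
    "nat \<Rightarrow> nat \<Rightarrow> (nat \<Rightarrow> nat \<Rightarrow> real) \<Rightarrow> (nat \<Rightarrow> real) \<Rightarrow> real" where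
  "dicker_estimator n p x y =
     (sq_norm p (\<lambda>j. \<Sum>i<n. x i j * y i) - real p * sq_norm n y) / (real n * (real n + 1))"

text \<open>
  Convergence in probability to a constant; the probability space may change with \<open>n\<close>.
\<close>

definition tendsto_in_prob ::
    "(nat \<Rightarrow> 'a measure) \<Rightarrow> (nat \<Rightarrow> 'a \<Rightarrow> real) \<Rightarrow> real \<Rightarrow> bool" where
  "tendsto_in_prob M Z c \<longleftrightarrow>
     (\<forall>\<delta>>0. (\<lambda>n. measure (M n) {\<omega> \<in> space (M n). \<bar>Z n \<omega> - c\<bar> > \<delta>}) \<longlonglongrightarrow> 0)"

end

theory Submission
  imports Defs
begin

text \<open>
  Let \<open>S = \<Sum>\<^sub>j \<Sum>\<^bsub>i \<noteq> k\<^esub> W\<^sub>i\<^sub>j W\<^sub>k\<^sub>j\<close> and \<open>D = \<Sum>\<^sub>i Y\<^sub>i\<^sup>2 (\<parallel>X\<^sub>i\<parallel>\<^sup>2 - p)\<close>. Then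
  \<open>\<parallel>X\<^sup>TY\<parallel>\<^sup>2 - p \<parallel>Y\<parallel>\<^sup>2 = S + D\<close>, so the estimators differ by \<open>2 S / (n (n - 1) (n + 1)) - D / (n (n + 1))\<close>.
  Since \<open>\<bar>S\<bar> \<le> \<parallel>X\<^sup>TY\<parallel>\<^sup>2 + \<Sum>\<^sub>i\<^sub>j W\<^sub>i\<^sub>j\<^sup>2\<close>, we have \<open>E \<bar>S\<bar> = O(n\<^sup>2 + n p)\<close>. The summands of \<open>D\<close> are independent
  with mean \<open>2 \<tau>\<^sup>2\<close>, which stays bounded although each summand has order \<open>\<surd>p\<close>, and second moment
  \<open>O(p)\<close>; hence \<open>E D\<^sup>2 = O(n p + n\<^sup>2)\<close>. Markov's inequality for \<open>\<bar>S\<bar>\<close> and Chebyshev's for \<open>D\<close> conclude.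
\<close>

subsection \<open>Finite moments and Gaussian vectors\<close>

text \<open>All powers are required at once because this class, unlike that of integrable functions,
  is closed under products. Integrability of any polynomial in such variables then follows from
  structural rules. The case \<open>k = 0\<close> forces the measure to be finite.\<close>

definition has_moments :: "'a measure \<Rightarrow> ('a \<Rightarrow> real) \<Rightarrow> bool" where
  "has_moments M f \<longleftrightarrow> f \<in> borel_measurable M \<and> (\<forall>k. integrable M (\<lambda>x. f x ^ k))"

lemma has_momentsD:
  assumes "has_moments M f"
  shows "f \<in> borel_measurable M" "integrable M (\<lambda>x. f x ^ k)" "integrable M (\<lambda>x. \<bar>f x\<bar> ^ k)"
    "integrable M f"
proof -
  show *: "f \<in> borel_measurable M" "integrable M (\<lambda>x. f x ^ k)" for k
    using assms by (auto simp: has_moments_def)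
  show "integrable M (\<lambda>x. \<bar>f x\<bar> ^ k)"
    using integrable_abs[OF *(2)[of k]] by (simp add: power_abs)
  show "integrable M f" using *(2)[of 1] by simp
qed

lemma has_moments_power:
  assumes "has_moments M f" shows "has_moments M (\<lambda>x. f x ^ k)"
  using assms by (auto simp: has_moments_def simp flip: power_mult)

lemma has_moments_mult:
  assumes f: "has_moments M f" and g: "has_moments M g"
  shows "has_moments M (\<lambda>x. f x * g x)"
  unfolding has_moments_def
proof (intro conjI allI)
  note [measurable] = has_momentsD(1)[OF f] has_momentsD(1)[OF g]
  show "(\<lambda>x. f x * g x) \<in> borel_measurable M" by simp
  fix k
  \<comment> \<open>Applied to \<open>a ^ k\<close> and \<open>b ^ k\<close>, this elementary bound
    dominates every power of the product by even powers of the factors, without Hoelder's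
    inequality.\<close>
  have "\<bar>a * b\<bar> \<le> a\<^sup>2 + b\<^sup>2" for a b :: real
    using zero_le_power2[of "a + b"] zero_le_power2[of "a - b"]
    by (simp add: power2_eq_square abs_if algebra_simps split: if_splits)
  then have le: "\<bar>(a * b) ^ k\<bar> \<le> a ^ (k * 2) + b ^ (k * 2)" for a b :: real
    unfolding power_mult_distrib power_mult by blast
  show "integrable M (\<lambda>x. (f x * g x) ^ k)"
    by (rule Bochner_Integration.integrable_bound[of M "\<lambda>x. f x ^ (k * 2) + g x ^ (k * 2)"])
      (auto intro!: has_momentsD(2,3) f g AE_I2 order_trans[OF le])
qed

lemma has_moments_add:
  assumes f: "has_moments M f" and g: "has_moments M g"
  shows "has_moments M (\<lambda>x. f x + g x)"
  unfolding has_moments_def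
proof (intro conjI allI)
  note [measurable] = has_momentsD(1)[OF f] has_momentsD(1)[OF g]
  show "(\<lambda>x. f x + g x) \<in> borel_measurable M" by simp
  fix k
  have le: "\<bar>(a + b) ^ k\<bar> \<le> 2 ^ k * (\<bar>a\<bar> ^ k + \<bar>b\<bar> ^ k)" for a b :: real
  proof -
    \<comment> \<open>Bounding the sum by twice the larger summand gives the factor
      \<open>2 ^ k\<close> without a binomial expansion.\<close>
    have "\<bar>a + b\<bar> ^ k \<le> (2 * max \<bar>a\<bar> \<bar>b\<bar>) ^ k"
      by (rule power_mono) auto
    also have "\<dots> \<le> 2 ^ k * (\<bar>a\<bar> ^ k + \<bar>b\<bar> ^ k)"
      by (auto simp: power_mult_distrib max_def)
    finally show ?thesis by (simp add: power_abs)
  qed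
  show "integrable M (\<lambda>x. (f x + g x) ^ k)"
    by (rule Bochner_Integration.integrable_bound[of M "\<lambda>x. 2 ^ k * (\<bar>f x\<bar> ^ k + \<bar>g x\<bar> ^ k)"])
      (auto intro!: has_momentsD(2,3) f g AE_I2 order_trans[OF le])
qed

lemma (in prob_space) has_moments_const: "has_moments M (\<lambda>x. c)"
  by (simp add: has_moments_def)

lemma (in prob_space) has_moments_diff:
  assumes "has_moments M f" "has_moments M g"
  shows "has_moments M (\<lambda>x. f x - g x)"
  using has_moments_add[OF assms(1) has_moments_mult[OF has_moments_const[of "-1"] assms(2)]] by simp

lemma (in prob_space) has_moments_sum:
  assumes "\<And>i. i \<in> I \<Longrightarrow> has_moments M (f i)"
  shows "has_moments M (\<lambda>x. \<Sum>i\<in>I. f i x)"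
  using assms
  by (induction I rule: infinite_finite_induct) (auto intro: has_moments_const has_moments_add)

lemmas (in prob_space) has_moments_intros =
  has_moments_power has_moments_mult has_moments_add has_moments_const has_moments_diff
  has_moments_sum

lemma has_moments_cong:
  assumes "\<And>x. x \<in> space M \<Longrightarrow> f x = g x"
  shows "has_moments M f \<longleftrightarrow> has_moments M g"
proof -
  have "f \<in> borel_measurable M \<longleftrightarrow> g \<in> borel_measurable M"
    using assms by (rule measurable_cong)
  moreover have "integrable M (\<lambda>x. f x ^ k) \<longleftrightarrow> integrable M (\<lambda>x. g x ^ k)" for k
    by (rule Bochner_Integration.integrable_cong) (auto simp: assms)
  ultimately show ?thesis by (simp add: has_moments_def)
qed

section \<open>Moments of normal variables and of sums of independent variables\<close>

lemma (in prob_space) normal_moments: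
  assumes [measurable]: "f \<in> borel_measurable M" and s: "0 \<le> s"
    and distr: "distr M borel f = normal_dist 0 s"
  shows "has_moments M f"
    and "expectation (\<lambda>x. f x ^ (2 * k)) = fact (2 * k) / (2 ^ k * fact k) * s ^ (2 * k)"
    and "expectation (\<lambda>x. f x ^ (2 * k + 1)) = 0"
proof -
  have "integrable M (\<lambda>x. f x ^ m) \<and>
      expectation (\<lambda>x. f x ^ (2 * k)) = fact (2 * k) / (2 ^ k * fact k) * s ^ (2 * k) \<and>
      expectation (\<lambda>x. f x ^ (2 * k + 1)) = 0" for m
  \<comment> \<open>A vanishing error variance or coefficient vector is allowed, and then
    \<open>normal_dist\<close> is a point mass without a density.\<close>
  proof (cases "s = 0")
    case True
    then have d: "distr M borel f = return borel 0" using distr by (simp add: normal_dist_def)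
    have "AE x in distr M borel f. x = 0"
      unfolding d by (simp add: AE_return)
    then have AE: "AE x in M. f x = 0" by (simp add: AE_distr_iff)
    \<comment> \<open>The value is written \<open>0 ^ m\<close> so that \<open>m = 0\<close> gives
      1, in agreement with the even moment formula at \<open>k = 0\<close>.\<close>
    have *: "integrable M (\<lambda>x. f x ^ m) \<and> expectation (\<lambda>x. f x ^ m) = 0 ^ m" for m
    proof
      have "integrable M (\<lambda>x. f x ^ m) \<longleftrightarrow> integrable M (\<lambda>x. 0 ^ m :: real)"
        using AE by (intro integrable_cong_AE) auto
      then show "integrable M (\<lambda>x. f x ^ m)" by simp
      have "expectation (\<lambda>x. f x ^ m) = expectation (\<lambda>x. 0 ^ m)"
        using AE by (intro integral_cong_AE) auto
      then show "expectation (\<lambda>x. f x ^ m) = 0 ^ m" by (simp add: prob_space)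
    qed
    show ?thesis using * True by (simp add: power_0_left del: power_Suc)
  next
    case False
    with s have s: "0 < s" by simp
    have d: "distr M borel f = density lborel (normal_density 0 s)"
      using distr False by (simp add: normal_dist_def)
    have eq: "expectation (\<lambda>x. f x ^ m) = (\<integral>x. normal_density 0 s x * (x - 0) ^ m \<partial>lborel)" for m
    proof -
      have "expectation (\<lambda>x. f x ^ m) = (\<integral>x. x ^ m \<partial>distr M borel f)"
        by (simp add: integral_distr)
      then show ?thesis unfolding d by (simp add: integral_density)
    qed
    have "integrable (distr M borel f) (\<lambda>x. x ^ m)"
      unfolding d using integrable_normal_moment[OF s, of 0 m] by (simp add: integrable_density)
    then have "integrable M (\<lambda>x. f x ^ m)" by (simp add: integrable_distr_eq)
    then show ?thesis
      unfolding eq integral_normal_moment_even[OF s] integral_normal_moment_odd[OF s]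
      using s by (simp add: power_divide power_mult)
  qed
  then show "has_moments M f"
    and "expectation (\<lambda>x. f x ^ (2 * k)) = fact (2 * k) / (2 ^ k * fact k) * s ^ (2 * k)"
    and "expectation (\<lambda>x. f x ^ (2 * k + 1)) = 0"
    by (auto simp: has_moments_def)
qed

lemma (in prob_space) expectation_indep_mult:
  assumes "indep_var borel X borel Y" "has_moments M X" "has_moments M Y"
  shows "expectation (\<lambda>x. X x ^ k * Y x ^ l) = expectation (\<lambda>x. X x ^ k) * expectation (\<lambda>x. Y x ^ l)"
proof -
  have "indep_var borel ((\<lambda>x. x ^ k) \<circ> X) borel ((\<lambda>x. x ^ l) \<circ> Y)"
    using assms(1) by (rule indep_var_compose) auto
  then show ?thesis
    using assms(2,3) by (subst indep_var_lebesgue_integral) (auto simp: o_def has_momentsD)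
qed

lemma (in prob_space) indep_vars_expectation_mult:
  assumes "indep_vars (\<lambda>_. borel) Z I" "i \<in> I" "k \<in> I" "i \<noteq> k"
    "has_moments M (Z i)" "has_moments M (Z k)"
  shows "expectation (\<lambda>x. Z i x * Z k x) = expectation (Z i) * expectation (Z k)"
proof -
  \<comment> \<open>Summing over the singleton \<open>{k}\<close> makes
    \<open>indep_vars_sum\<close> deliver independence of just two members of the family.\<close>
  have "indep_var borel (Z i) borel (\<lambda>x. \<Sum>l\<in>{k}. Z l x)"
    using assms(2-4) by (intro indep_vars_sum indep_vars_subset[OF assms(1)]) auto
  then show ?thesis
    using assms(5,6) expectation_indep_mult[of "Z i" "Z k" 1 1] by simp
qed

text \<open>After expanding the square, each off-diagonal product factors into
  \<open>m\<^sup>2\<close>. The bound serves both the sum of the diagonal terms and each column sum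
  of \<open>W\<close>.\<close>

lemma (in prob_space) indep_sum_second_moment:
  fixes n :: nat
  assumes indep: "indep_vars (\<lambda>_. borel) Z {..<n}"
    and mom: "\<And>i. i < n \<Longrightarrow> has_moments M (Z i)"
    and mean: "\<And>i. i < n \<Longrightarrow> expectation (Z i) = m"
  shows "expectation (\<lambda>x. (\<Sum>i<n. Z i x)\<^sup>2) \<le> (\<Sum>i<n. expectation (\<lambda>x. (Z i x)\<^sup>2)) + (real n)\<^sup>2 * m\<^sup>2"
proof -
  have "expectation (\<lambda>x. (\<Sum>i<n. Z i x)\<^sup>2) = expectation (\<lambda>x. \<Sum>i<n. \<Sum>k<n. Z i x * Z k x)"
    by (simp add: power2_eq_square sum_product)
  also have "\<dots> = (\<Sum>i<n. \<Sum>k<n. expectation (\<lambda>x. Z i x * Z k x))"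
    by (subst Bochner_Integration.integral_sum, (intro has_momentsD(4) has_moments_intros mom; simp),
      intro sum.cong refl Bochner_Integration.integral_sum has_momentsD(4) has_moments_intros mom)
      auto
  \<comment> \<open>The diagonal also receives a nonnegative \<open>m\<^sup>2\<close>, so that the
    count of such terms is \<open>n\<^sup>2\<close> instead of \<open>n (n - 1)\<close>.\<close>
  also have "\<dots> \<le> (\<Sum>i<n. \<Sum>k<n. (if k = i then expectation (\<lambda>x. (Z i x)\<^sup>2) else 0) + m\<^sup>2)"
  proof (intro sum_mono)
    fix i k assume "i \<in> {..<n}" "k \<in> {..<n}"
    then show "expectation (\<lambda>x. Z i x * Z k x) \<le>
        (if k = i then expectation (\<lambda>x. (Z i x)\<^sup>2) else 0) + m\<^sup>2"
      using indep_vars_expectation_mult[OF indep, of i k] mom mean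
      by (auto simp: power2_eq_square)
  qed
  also have "\<dots> = (\<Sum>i<n. expectation (\<lambda>x. (Z i x)\<^sup>2)) + (real n)\<^sup>2 * m\<^sup>2"
    by (simp add: sum.distrib power2_eq_square)
  finally show ?thesis .
qed

section \<open>Linear and quadratic forms in independent standard normals\<close>

locale iid_std_normal = prob_space +
  fixes p :: nat and \<xi> :: "nat \<Rightarrow> 'a \<Rightarrow> real"
  assumes indep: "indep_vars (\<lambda>_. borel) \<xi> {..<p}"
    and normal: "\<And>j. j < p \<Longrightarrow> distr M borel (\<xi> j) = std_normal_distribution"
begin

lemma measurable_xi [measurable]: "j < p \<Longrightarrow> \<xi> j \<in> borel_measurable M"
  using indep by (auto simp: indep_vars_def)

lemma xi_normal: "j < p \<Longrightarrow> distr M borel (\<xi> j) = normal_dist 0 1"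
  using normal by (simp add: normal_dist_def)

lemmas xi_moments = normal_moments[OF measurable_xi _ xi_normal]

lemma has_moments_xi: "j < p \<Longrightarrow> has_moments M (\<xi> j)"
  by (rule xi_moments) auto

lemma xi_moment_values:
  assumes "j < p"
  shows "expectation (\<xi> j) = 0" "expectation (\<lambda>x. \<xi> j x ^ 2) = 1"
    "expectation (\<lambda>x. \<xi> j x ^ 3) = 0"
    "expectation (\<lambda>x. \<xi> j x ^ 4) = 3" "expectation (\<lambda>x. \<xi> j x ^ 6) = 15"
    "expectation (\<lambda>x. \<xi> j x ^ 8) = 105"
  using xi_moments(3)[of j 0] xi_moments(3)[of j 1] xi_moments(2)[of j 1] xi_moments(2)[of j 2]
    xi_moments(2)[of j 3] xi_moments(2)[of j 4] assms
  by (auto simp: fact_numeral)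

lemma has_moments_linear: "has_moments M (\<lambda>x. \<Sum>j<p. b j * \<xi> j x)"
  by (intro has_moments_intros has_moments_xi) auto

lemma has_moments_quadratic: "has_moments M (\<lambda>x. \<Sum>j<p. (\<xi> j x)\<^sup>2 - 1)"
  by (intro has_moments_intros has_moments_xi) auto

lemma linear_normal:
  "distr M borel (\<lambda>x. \<Sum>j<p. b j * \<xi> j x) = normal_dist 0 (sqrt (\<Sum>j<p. (b j)\<^sup>2))"
proof -
  \<comment> \<open>Zero coefficients are dropped because \<open>sum_indep_normal\<close> asks for
    positive standard deviations. If none remain, the sum is the point mass at 0.\<close>
  define J where "J = {j. j < p \<and> b j \<noteq> 0}"
  have J: "finite J" "J \<subseteq> {..<p}" unfolding J_def by auto
  have eq: "(\<Sum>j<p. b j * \<xi> j x) = (\<Sum>j\<in>J. b j * \<xi> j x)" for x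
    by (rule sum.mono_neutral_right) (auto simp: J_def)
  have eq2: "(\<Sum>j<p. (b j)\<^sup>2) = (\<Sum>j\<in>J. (b j)\<^sup>2)"
    by (rule sum.mono_neutral_right) (auto simp: J_def)
  show ?thesis
  proof (cases "J = {}")
    case True
    then show ?thesis unfolding eq eq2 by (simp add: normal_dist_def)
  next
    case False
    have "distributed M lborel (\<lambda>x. \<Sum>j\<in>J. b j * \<xi> j x)
        (normal_density (\<Sum>j\<in>J. 0) (sqrt (\<Sum>j\<in>J. \<bar>b j\<bar>\<^sup>2)))"
    proof (rule sum_indep_normal)
      show "indep_vars (\<lambda>i. borel) (\<lambda>j x. b j * \<xi> j x) J"
        by (rule indep_vars_compose2[OF indep_vars_subset[OF indep J(2)]]) auto
      fix j assume j: "j \<in> J"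
      then have jp: "j < p" using J by auto
      have "distr M lborel (\<xi> j) = distr M borel (\<xi> j)" by (rule distr_cong) auto
      then have "distributed M lborel (\<xi> j) std_normal_density"
        using jp normal[OF jp] by (simp add: distributed_def)
      from normal_density_affine[OF this, of "b j" 0]
      show "distributed M lborel (\<lambda>x. b j * \<xi> j x) (normal_density 0 \<bar>b j\<bar>)"
        using j by (simp add: J_def)
    qed (use J False in \<open>auto simp: J_def\<close>)
    moreover have "distr M lborel (\<lambda>x. \<Sum>j\<in>J. b j * \<xi> j x) = distr M borel (\<lambda>x. \<Sum>j\<in>J. b j * \<xi> j x)"
      by (rule distr_cong) auto
    moreover have "0 < (\<Sum>j\<in>J. (b j)\<^sup>2)"
      using J False by (intro sum_pos) (auto simp: J_def)
    ultimately show ?thesis unfolding eq eq2 by (simp add: distributed_def normal_dist_def)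
  qed
qed

lemma linear_moments:
  defines "L \<equiv> \<lambda>b x. \<Sum>j<p. b j * \<xi> j x"
  shows "expectation (\<lambda>x. (L b x)\<^sup>2) = (\<Sum>j<p. (b j)\<^sup>2)"
    and "expectation (\<lambda>x. L b x ^ 8) = 105 * (\<Sum>j<p. (b j)\<^sup>2) ^ 4"
proof -
  have L: "L b \<in> borel_measurable M" unfolding L_def by measurable
  have d: "distr M borel (L b) = normal_dist 0 (sqrt (\<Sum>j<p. (b j)\<^sup>2))"
    unfolding L_def by (rule linear_normal)
  have "0 \<le> sqrt (\<Sum>j<p. (b j)\<^sup>2)" by (simp add: sum_nonneg)
  note m = normal_moments(2)[OF L this d]
  show "expectation (\<lambda>x. (L b x)\<^sup>2) = (\<Sum>j<p. (b j)\<^sup>2)"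
    using m[of 1] by (simp add: sum_nonneg)
  have "sqrt s ^ 8 = s ^ 4" if "0 \<le> s" for s
    using that power_mult[of "sqrt s" 2 4] by simp
  then show "expectation (\<lambda>x. L b x ^ 8) = 105 * (\<Sum>j<p. (b j)\<^sup>2) ^ 4"
    using m[of 4] by (simp add: sum_nonneg fact_numeral)
qed

lemma chisq_expectation: "expectation (\<lambda>x. \<Sum>j<p. (\<xi> j x)\<^sup>2 - 1) = 0"
  by (simp add: has_momentsD has_moments_xi xi_moment_values prob_space)

lemma centered_square_moments:
  assumes "j < p"
  shows "expectation (\<lambda>x. (\<xi> j x)\<^sup>2 - 1) = 0"
    and "expectation (\<lambda>x. ((\<xi> j x)\<^sup>2 - 1)\<^sup>2) = 2"
    and "expectation (\<lambda>x. ((\<xi> j x)\<^sup>2 - 1) ^ 4) = 60"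
proof -
  note i = has_momentsD(2)[OF has_moments_xi[OF assms]]
  show "expectation (\<lambda>x. (\<xi> j x)\<^sup>2 - 1) = 0"
    using assms by (simp add: i xi_moment_values prob_space)
  have "(a\<^sup>2 - 1)\<^sup>2 = a ^ 4 - 2 * a ^ 2 + 1" for a :: real by algebra
  then show "expectation (\<lambda>x. ((\<xi> j x)\<^sup>2 - 1)\<^sup>2) = 2"
    using assms by (simp add: i xi_moment_values prob_space)
  \<comment> \<open>The even normal moments 105, 15, 3 and 1 give 105 - 60 + 18 - 4 + 1 =
    60.\<close>
  have "(a\<^sup>2 - 1) ^ 4 = a ^ 8 - 4 * a ^ 6 + 6 * a ^ 4 - 4 * a ^ 2 + 1" for a :: real by algebra
  then show "expectation (\<lambda>x. ((\<xi> j x)\<^sup>2 - 1) ^ 4) = 60"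
    using assms by (simp add: i xi_moment_values prob_space)
qed

text \<open>Centering makes the growth quadratic in \<open>p\<close> instead of quartic. A new
  summand \<open>z\<close> is independent of the partial sum \<open>S\<close> of \<open>k\<close>
  terms and both have mean zero, so the only surviving mixed term is
  \<open>6 z\<^sup>2 S\<^sup>2\<close>, with expectation \<open>6 * 2 * 2k = 24k\<close>.\<close>

lemma chisq_fourth_moment:
  "expectation (\<lambda>x. (\<Sum>j<p. (\<xi> j x)\<^sup>2 - 1) ^ 4) \<le> 60 * (real p)\<^sup>2"
proof -
  define z where "z = (\<lambda>j x. (\<xi> j x)\<^sup>2 - 1)"
  have z: "has_moments M (z j)" if "j < p" for j
    unfolding z_def using that by (intro has_moments_intros has_moments_xi)
  have ind: "indep_vars (\<lambda>_. borel) z {..<p}"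
    unfolding z_def by (rule indep_vars_compose2[OF indep]) auto
  \<comment> \<open>The three moments are carried together, since the step for the fourth uses the
    first two.\<close>
  have "expectation (\<lambda>x. \<Sum>j<k. z j x) = 0 \<and>
      expectation (\<lambda>x. (\<Sum>j<k. z j x)\<^sup>2) = 2 * real k \<and>
      expectation (\<lambda>x. (\<Sum>j<k. z j x) ^ 4) = 60 * real k + 12 * real k * (real k - 1)" if "k \<le> p" for k
    using that
  proof (induction k)
    case 0
    then show ?case by simp
  next
    case (Suc k)
    define S where "S = (\<lambda>x. \<Sum>j<k. z j x)"
    have k: "k < p" using Suc by simp
    have S: "has_moments M S" unfolding S_def using k by (intro has_moments_intros z) auto
    have "indep_var borel (z k) borel S"
      unfolding S_def by (rule indep_vars_sum) (use k in \<open>auto intro: indep_vars_subset[OF ind]\<close>)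
    note e = expectation_indep_mult[OF this z[OF k] S]
    have i: "integrable M (\<lambda>x. z k x ^ a * S x ^ b)" for a b
      by (intro has_momentsD(4) has_moments_intros z k S)
    \<comment> \<open>Instances with exponent 0 or 1 are stored simplified, because the expansions
      below contain bare factors.\<close>
    note i' = i[of _ 1, simplified] i[of 1 _, simplified] i[of _ 0, simplified] i[of 0 _, simplified] i[of 1 1, simplified]
    note e' = e[of _ 1, simplified] e[of 1 _, simplified] e[of 1 1, simplified]
    have zm: "expectation (z k) = 0" "expectation (\<lambda>x. (z k x)\<^sup>2) = 2" "expectation (\<lambda>x. z k x ^ 4) = 60"
      using centered_square_moments[OF k] by (auto simp: z_def)
    have IH: "expectation S = 0" "expectation (\<lambda>x. (S x)\<^sup>2) = 2 * real k"
      "expectation (\<lambda>x. S x ^ 4) = 60 * real k + 12 * real k * (real k - 1)"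
      using Suc by (auto simp: S_def)
    have sm: "(\<Sum>j<Suc k. z j x) = z k x + S x" for x by (simp add: S_def)
    have 1: "expectation (\<lambda>x. z k x + S x) = 0"
      by (simp add: has_momentsD z k S zm IH)
    have "expectation (\<lambda>x. (z k x + S x)\<^sup>2) =
        expectation (\<lambda>x. (z k x)\<^sup>2 + 2 * (z k x * S x) + (S x)\<^sup>2)"
      by (intro arg_cong[where f=expectation] ext) algebra
    also have "\<dots> = 2 + 2 * real k" by (simp add: i i' e' zm IH)
    finally have 2: "expectation (\<lambda>x. (z k x + S x)\<^sup>2) = 2 + 2 * real k" .
    have "expectation (\<lambda>x. (z k x + S x) ^ 4) = expectation (\<lambda>x. z k x ^ 4 + 4 * (z k x ^ 3 * S x)
        + 6 * ((z k x)\<^sup>2 * (S x)\<^sup>2) + 4 * (z k x * S x ^ 3) + S x ^ 4)"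
      by (intro arg_cong[where f=expectation] ext) algebra
    also have "\<dots> = 60 + 24 * real k + 60 * real k + 12 * real k * (real k - 1)"
      by (simp add: i i' e e' zm IH)
    finally show ?case unfolding sm using 1 2 by (simp add: algebra_simps)
  qed
  from this[of p] have "expectation (\<lambda>x. (\<Sum>j<p. z j x) ^ 4) = 60 * real p + 12 * real p * (real p - 1)"
    by simp
  also have "\<dots> \<le> 60 * (real p)\<^sup>2"
  proof -
    have "real p \<le> (real p)\<^sup>2" by (cases p) (auto simp: power2_eq_square algebra_simps)
    then show ?thesis by (simp add: power2_eq_square algebra_simps)
  qed
  finally show ?thesis by (simp add: z_def)
qed

text \<open>This is the cancellation that keeps the mean of a diagonal term free of
  \<open>p\<close>. Against the centered square of coordinate \<open>l\<close>, the part of the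
  linear form without that coordinate averages to zero, and \<open>b l * \<xi> l\<close> contributes
  \<open>(b l)\<^sup>2 * (3 - 1)\<close>.\<close>

lemma linear_square_chisq:
  "expectation (\<lambda>x. (\<Sum>j<p. b j * \<xi> j x)\<^sup>2 * (\<Sum>j<p. (\<xi> j x)\<^sup>2 - 1)) = 2 * (\<Sum>j<p. (b j)\<^sup>2)"
proof -
  have *: "expectation (\<lambda>x. (\<Sum>j<p. b j * \<xi> j x)\<^sup>2 * ((\<xi> l x)\<^sup>2 - 1)) = 2 * (b l)\<^sup>2" if l: "l < p" for l
  proof -
    define R where "R = (\<lambda>x. \<Sum>j\<in>{..<p} - {l}. b j * \<xi> j x)"
    have R: "has_moments M R" unfolding R_def by (intro has_moments_intros has_moments_xi) auto
    note X = has_moments_xi[OF l]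
    \<comment> \<open>Coefficient 1 at \<open>l\<close> makes the singled-out member
      \<open>\<xi> l\<close> itself, even when \<open>b l\<close> is zero, while the others keep the
      weights that occur in \<open>R\<close>.\<close>
    have ind: "indep_vars (\<lambda>_. borel) (\<lambda>j x. (if j = l then 1 else b j) * \<xi> j x) {..<p}"
      by (rule indep_vars_compose2[OF indep]) auto
    have "indep_var borel (\<lambda>x. (if l = l then 1 else b l) * \<xi> l x) borel
       (\<lambda>x. \<Sum>j\<in>{..<p} - {l}. (if j = l then 1 else b j) * \<xi> j x)"
      by (rule indep_vars_sum[OF _ _ indep_vars_subset[OF ind]]) (use l in auto)
    moreover have "(\<lambda>x. \<Sum>j\<in>{..<p} - {l}. (if j = l then 1 else b j) * \<xi> j x) = R"
      unfolding R_def by (intro ext sum.cong) auto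
    ultimately have "indep_var borel (\<xi> l) borel R" by simp
    note e = expectation_indep_mult[OF this X R]
    have i: "integrable M (\<lambda>x. \<xi> l x ^ a * R x ^ b)" for a b
      by (intro has_momentsD(4) has_moments_intros X R)
    note i' = i[of _ 1, simplified] i[of 1 _, simplified] i[of _ 0, simplified] i[of 0 _, simplified] i[of 1 1, simplified]
    note e' = e[of _ 1, simplified] e[of 1 _, simplified] e[of 1 1, simplified]
    have sm: "(\<Sum>j<p. b j * \<xi> j x) = b l * \<xi> l x + R x" for x
      unfolding R_def using l by (subst sum.remove[of _ l]) auto
    have "expectation (\<lambda>x. (b l * \<xi> l x + R x)\<^sup>2 * ((\<xi> l x)\<^sup>2 - 1)) =
      expectation (\<lambda>x. (b l)\<^sup>2 * \<xi> l x ^ 4 - (b l)\<^sup>2 * (\<xi> l x)\<^sup>2 + 2 * b l * (\<xi> l x ^ 3 * R x)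
        - 2 * b l * (\<xi> l x * R x) + (\<xi> l x)\<^sup>2 * (R x)\<^sup>2 - (R x)\<^sup>2)"
      by (intro arg_cong[where f=expectation] ext) algebra
    also have "\<dots> = 2 * (b l)\<^sup>2"
      using l by (simp add: i i' e e' xi_moment_values)
    finally show ?thesis unfolding sm .
  qed
  have "expectation (\<lambda>x. (\<Sum>j<p. b j * \<xi> j x)\<^sup>2 * (\<Sum>j<p. (\<xi> j x)\<^sup>2 - 1)) =
     (\<Sum>l<p. expectation (\<lambda>x. (\<Sum>j<p. b j * \<xi> j x)\<^sup>2 * ((\<xi> l x)\<^sup>2 - 1)))"
    unfolding sum_distrib_left
    by (intro Bochner_Integration.integral_sum has_momentsD(4) has_moments_intros has_moments_xi) auto
  then show ?thesis by (simp add: * sum_distrib_left)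
qed

text \<open>The coordinates are orthonormal in L2, so only the coefficient at \<open>l\<close>
  survives. This supplies the mean of \<open>W\<close>.\<close>

lemma linear_covariance:
  assumes l: "l < p"
  shows "expectation (\<lambda>x. \<xi> l x * (\<Sum>j<p. b j * \<xi> j x)) = b l"
proof -
  have *: "expectation (\<lambda>x. \<xi> l x * \<xi> j x) = (if j = l then 1 else 0)" if j: "j < p" for j
  proof (cases "j = l")
    case False
    then show ?thesis
      using l j indep_vars_expectation_mult[OF indep, of l j]
      by (simp add: has_moments_xi xi_moment_values)
  qed (use l xi_moment_values(2)[OF l] in \<open>simp add: power2_eq_square\<close>)
  have "expectation (\<lambda>x. \<xi> l x * (\<Sum>j<p. b j * \<xi> j x)) =
      (\<Sum>j<p. expectation (\<lambda>x. b j * (\<xi> l x * \<xi> j x)))"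
    unfolding sum_distrib_left using l
    by (subst Bochner_Integration.integral_sum [symmetric])
      (auto intro!: has_momentsD(4) has_moments_intros has_moments_xi simp: ac_simps)
  also have "\<dots> = (\<Sum>j<p. if j = l then b j else 0)"
    by (intro sum.cong) (auto simp: *)
  also have "\<dots> = b l" using l by simp
  finally show ?thesis .
qed

end

subsection \<open>Moments in the Gaussian linear model\<close>

lemma vec_borel_component [measurable]:
  "j < p \<Longrightarrow> (\<lambda>x. x j) \<in> borel_measurable (vec_borel p)"
  by (rule measurable_component_singleton) simp

context gaussian_linear_model
begin

definition signal :: "nat \<Rightarrow> 'a \<Rightarrow> real" where
  "signal i \<omega> = (\<Sum>j<p. \<beta> j * X i \<omega> j)"

text \<open>The subtraction lies inside the sum, so this is the squared norm of row \<open>i\<close>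
  minus \<open>p\<close>, a centered chi-square variable.\<close>

definition excess :: "nat \<Rightarrow> 'a \<Rightarrow> real" where
  "excess i \<omega> = (\<Sum>j<p. (X i \<omega> j)\<^sup>2 - 1)"

abbreviation "\<tau>2 \<equiv> \<Sum>j<p. (\<beta> j)\<^sup>2"

section \<open>Measurability and laws of the observations\<close>

lemma measurable_XY [measurable]:
  assumes "i < n"
  shows "X i \<in> measurable M (vec_borel p)" "Y i \<in> borel_measurable M"
proof -
  have "(\<lambda>\<omega>. (X i \<omega>, Y i \<omega>)) \<in> M \<rightarrow>\<^sub>M vec_borel p \<Otimes>\<^sub>M borel"
    using indep_pairs assms by (auto simp: indep_vars_def)
  from measurable_compose[OF this measurable_fst] measurable_compose[OF this measurable_snd]
  show "X i \<in> measurable M (vec_borel p)" "Y i \<in> borel_measurable M" by simp_all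
qed

lemma measurable_X_component [measurable]:
  "i < n \<Longrightarrow> j < p \<Longrightarrow> (\<lambda>\<omega>. X i \<omega> j) \<in> borel_measurable M"
  by (rule measurable_compose[OF measurable_XY(1) vec_borel_component])

text \<open>Measurability of the squared error would leave its sign undetermined, so the error is
  recovered from the response equation.\<close>

lemma measurable_error [measurable]:
  assumes "i < n" shows "\<epsilon> i \<in> borel_measurable M"
proof -
  have "\<epsilon> i \<in> borel_measurable M \<longleftrightarrow> (\<lambda>\<omega>. Y i \<omega> - (\<Sum>j<p. \<beta> j * X i \<omega> j)) \<in> borel_measurable M"
    by (rule measurable_cong) (simp add: response assms)
  also have "\<dots>" using assms by measurable
  finally show ?thesis .
qed

lemma component_normal:
  assumes i: "i < n" and j: "j < p"
  shows "distr M borel (\<lambda>\<omega>. X i \<omega> j) = std_normal_distribution"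
proof -
  interpret std: prob_space std_normal_distribution
    by (simp add: prob_space_normal_density)
  interpret product_prob_space "\<lambda>_. std_normal_distribution" "{..<p}"
    by unfold_locales
  have "distr M borel (\<lambda>\<omega>. X i \<omega> j) = distr (distr M (vec_borel p) (X i)) borel (\<lambda>x. x j)"
    using i j by (subst distr_distr) (auto simp: o_def)
  also have "\<dots> = distr (PiM {..<p} (\<lambda>_. std_normal_distribution)) std_normal_distribution (\<lambda>x. x j)"
    unfolding X_normal[OF i] std_normal_vec_def by (rule distr_cong) auto
  also have "\<dots> = std_normal_distribution"
    by (rule PiM_component) (use j in auto)
  finally show ?thesis .
qed

text \<open>The law of a row is the product of its marginals, which characterizes independence of
  its coordinates. Every result on \<open>iid_std_normal\<close> then applies row by row.\<close>

lemma row_iid: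
  assumes i: "i < n"
  shows "iid_std_normal M p (\<lambda>j \<omega>. X i \<omega> j)"
proof
  show "distr M borel (\<lambda>\<omega>. X i \<omega> j) = std_normal_distribution" if "j < p" for j
    using i that by (rule component_normal)
  show "indep_vars (\<lambda>_. borel) (\<lambda>j \<omega>. X i \<omega> j) {..<p}"
  proof (cases "p = 0")
    \<comment> \<open>The characterization by product measures is used only for a nonempty index
      set.\<close>
    case True
    then show ?thesis by (simp add: indep_vars_def indep_sets_def)
  next
    case False
    have "distr M (vec_borel p) (\<lambda>\<omega>. \<lambda>j\<in>{..<p}. X i \<omega> j) = distr M (vec_borel p) (X i)"
    proof (rule distr_cong)
      fix \<omega> assume "\<omega> \<in> space M"
      then have "X i \<omega> \<in> space (vec_borel p)" by (rule measurable_space[OF measurable_XY(1)[OF i]])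
      then have "X i \<omega> \<in> extensional {..<p}" by (auto simp: space_PiM PiE_def)
      then show "(\<lambda>j\<in>{..<p}. X i \<omega> j) = X i \<omega>" by (rule extensional_restrict)
    qed auto
    also have "\<dots> = PiM {..<p} (\<lambda>j. distr M borel (\<lambda>\<omega>. X i \<omega> j))"
      unfolding X_normal[OF i] std_normal_vec_def
      by (rule PiM_cong) (auto simp: component_normal i)
    finally show ?thesis
      using False i by (subst indep_vars_iff_distr_eq_PiM') auto
  qed
qed

lemma has_moments_X: "i < n \<Longrightarrow> j < p \<Longrightarrow> has_moments M (\<lambda>\<omega>. X i \<omega> j)"
  by (rule iid_std_normal.has_moments_xi[OF row_iid])

lemma has_moments_signal: "i < n \<Longrightarrow> has_moments M (signal i)"
  unfolding signal_def by (rule iid_std_normal.has_moments_linear[OF row_iid])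

lemma has_moments_excess: "i < n \<Longrightarrow> has_moments M (excess i)"
  unfolding excess_def by (rule iid_std_normal.has_moments_quadratic[OF row_iid])

lemmas error_moments = normal_moments[OF measurable_error sigma_nonneg error_normal]

lemma has_moments_error: "i < n \<Longrightarrow> has_moments M (\<epsilon> i)"
  by (rule error_moments)

lemma response': "i < n \<Longrightarrow> \<omega> \<in> space M \<Longrightarrow> Y i \<omega> = signal i \<omega> + \<epsilon> i \<omega>"
  by (simp add: response signal_def)

lemma has_moments_Y: "i < n \<Longrightarrow> has_moments M (Y i)"
  using has_moments_add[OF has_moments_signal has_moments_error, of i i]
  by (subst has_moments_cong[OF response'])

section \<open>Conditional moments of the errors and moments of the response\<close>

text \<open>A function of the covariates is measurable for the sigma-algebra they generate, so it
  can be pulled through the conditional expectation. This takes the place of independence between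
  errors and covariates.\<close>

lemma cond_moments:
  assumes i: "i < n" and h [measurable]: "h \<in> borel_measurable (vec_borel p)"
    and mom: "has_moments M (\<lambda>\<omega>. h (X i \<omega>))"
  shows "expectation (\<lambda>\<omega>. h (X i \<omega>) * \<epsilon> i \<omega>) = 0"
    and "expectation (\<lambda>\<omega>. h (X i \<omega>) * (\<epsilon> i \<omega>)\<^sup>2) = \<sigma>\<^sup>2 * expectation (\<lambda>\<omega>. h (X i \<omega>))"
proof -
  let ?F = "vimage_algebra (space M) (X i) (vec_borel p)"
  have X: "X i \<in> space M \<rightarrow> space (vec_borel p)"
    using measurable_space[OF measurable_XY(1)[OF i]] by auto
  have sub: "subalgebra M ?F"
    using measurable_sets[OF measurable_XY(1)[OF i]] X
    by (auto simp: subalgebra_def sets_vimage_algebra2)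
  interpret F: finite_measure_subalgebra M ?F by unfold_locales (rule sub)
  have hX: "(\<lambda>\<omega>. h (X i \<omega>)) \<in> borel_measurable ?F"
    by (rule measurable_compose[OF measurable_vimage_algebra1[OF X] h])
  have e: "has_moments M (\<epsilon> i)" using i by (rule has_moments_error)
  have "expectation (\<lambda>\<omega>. h (X i \<omega>) * \<epsilon> i \<omega>) =
      expectation (\<lambda>\<omega>. h (X i \<omega>) * real_cond_exp M ?F (\<epsilon> i) \<omega>)"
    using i hX by (intro F.real_cond_exp_intg(2)[symmetric] has_momentsD(4) has_moments_mult mom e) auto
  also have "\<dots> = expectation (\<lambda>\<omega>. 0)"
    using error_cond_mean[OF i] i by (intro integral_cong_AE) (auto elim!: eventually_mono)
  finally show "expectation (\<lambda>\<omega>. h (X i \<omega>) * \<epsilon> i \<omega>) = 0" by simp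
  have "expectation (\<lambda>\<omega>. h (X i \<omega>) * (\<epsilon> i \<omega>)\<^sup>2) =
      expectation (\<lambda>\<omega>. h (X i \<omega>) * real_cond_exp M ?F (\<lambda>\<omega>. (\<epsilon> i \<omega>)\<^sup>2) \<omega>)"
    using i hX
    by (intro F.real_cond_exp_intg(2)[symmetric] has_momentsD(4) has_moments_intros mom e) auto
  also have "\<dots> = expectation (\<lambda>\<omega>. h (X i \<omega>) * \<sigma>\<^sup>2)"
    using error_cond_var[OF i] i by (intro integral_cong_AE) (auto elim!: eventually_mono)
  finally show "expectation (\<lambda>\<omega>. h (X i \<omega>) * (\<epsilon> i \<omega>)\<^sup>2) = \<sigma>\<^sup>2 * expectation (\<lambda>\<omega>. h (X i \<omega>))"
    by simp
qed

text \<open>Expanding \<open>Y\<close> as signal plus error, the cross term vanishes and the squared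
  error averages to \<open>\<sigma>\<^sup>2\<close>. The weights used later are the constant 1 and
  \<open>excess\<close>.\<close>

lemma expectation_Y_sq_times:
  assumes i: "i < n" and h [measurable]: "h \<in> borel_measurable (vec_borel p)"
    and mom: "has_moments M (\<lambda>\<omega>. h (X i \<omega>))"
  shows "expectation (\<lambda>\<omega>. (Y i \<omega>)\<^sup>2 * h (X i \<omega>)) =
    expectation (\<lambda>\<omega>. (signal i \<omega>)\<^sup>2 * h (X i \<omega>)) + \<sigma>\<^sup>2 * expectation (\<lambda>\<omega>. h (X i \<omega>))"
proof -
  note m = has_moments_signal[OF i] has_moments_error[OF i] mom
  \<comment> \<open>The weight times the signal is again a function of the covariate row, so the
    conditional mean removes the cross term.\<close>
  have "(\<lambda>x. h x * (\<Sum>j<p. \<beta> j * x j)) \<in> borel_measurable (vec_borel p)" by measurable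
  from cond_moments(1)[OF i this]
  have cross: "expectation (\<lambda>\<omega>. h (X i \<omega>) * signal i \<omega> * \<epsilon> i \<omega>) = 0"
    unfolding signal_def[symmetric] by (simp add: has_moments_intros m)
  have "expectation (\<lambda>\<omega>. (Y i \<omega>)\<^sup>2 * h (X i \<omega>)) =
    expectation (\<lambda>\<omega>. (signal i \<omega>)\<^sup>2 * h (X i \<omega>) + 2 * (h (X i \<omega>) * signal i \<omega> * \<epsilon> i \<omega>)
      + h (X i \<omega>) * (\<epsilon> i \<omega>)\<^sup>2)"
    by (rule Bochner_Integration.integral_cong)
      (auto simp: response'[OF i] power2_eq_square algebra_simps)
  also have "\<dots> = expectation (\<lambda>\<omega>. (signal i \<omega>)\<^sup>2 * h (X i \<omega>))
      + 2 * expectation (\<lambda>\<omega>. h (X i \<omega>) * signal i \<omega> * \<epsilon> i \<omega>)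
      + expectation (\<lambda>\<omega>. h (X i \<omega>) * (\<epsilon> i \<omega>)\<^sup>2)"
    by (simp add: has_momentsD has_moments_intros m)
  finally show ?thesis by (simp add: cross cond_moments(2)[OF i h mom])
qed

lemma expectation_Y_sq: "i < n \<Longrightarrow> expectation (\<lambda>\<omega>. (Y i \<omega>)\<^sup>2) = \<tau>2 + \<sigma>\<^sup>2"
  using expectation_Y_sq_times[of i "\<lambda>_. 1"] iid_std_normal.linear_moments(1)[OF row_iid, of i \<beta>]
  by (simp add: has_moments_const signal_def prob_space)

text \<open>The noise contributes nothing because \<open>excess\<close> has mean zero; only the
  signal is correlated with it.\<close>

lemma expectation_Y_sq_excess:
  assumes i: "i < n"
  shows "expectation (\<lambda>\<omega>. (Y i \<omega>)\<^sup>2 * excess i \<omega>) = 2 * \<tau>2"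
proof -
  have "expectation (excess i) = 0"
    unfolding excess_def by (rule iid_std_normal.chisq_expectation[OF row_iid[OF i]])
  moreover have "expectation (\<lambda>\<omega>. (signal i \<omega>)\<^sup>2 * excess i \<omega>) = 2 * \<tau>2"
    unfolding excess_def signal_def by (rule iid_std_normal.linear_square_chisq[OF row_iid[OF i]])
  ultimately show ?thesis
    using expectation_Y_sq_times[OF i, of "\<lambda>x. \<Sum>j<p. (x j)\<^sup>2 - 1"] has_moments_excess[OF i]
    by (simp add: excess_def[abs_def])
qed

lemma expectation_W:
  assumes i: "i < n" and j: "j < p"
  shows "expectation (\<lambda>\<omega>. W (\<lambda>i. X i \<omega>) (\<lambda>i. Y i \<omega>) i j) = \<beta> j"
proof -
  note m = has_moments_signal[OF i] has_moments_error[OF i] has_moments_X[OF i j]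
  have "expectation (\<lambda>\<omega>. W (\<lambda>i. X i \<omega>) (\<lambda>i. Y i \<omega>) i j) =
     expectation (\<lambda>\<omega>. X i \<omega> j * signal i \<omega> + X i \<omega> j * \<epsilon> i \<omega>)"
    unfolding W_def
    by (rule Bochner_Integration.integral_cong) (auto simp: response'[OF i] algebra_simps)
  also have "\<dots> = expectation (\<lambda>\<omega>. X i \<omega> j * signal i \<omega>) + expectation (\<lambda>\<omega>. X i \<omega> j * \<epsilon> i \<omega>)"
    by (simp add: has_momentsD has_moments_intros m)
  also have "\<dots> = \<beta> j"
    using iid_std_normal.linear_covariance[OF row_iid[OF i] j, of \<beta>]
      cond_moments(1)[OF i vec_borel_component[OF j] has_moments_X[OF i j]]
    by (simp add: signal_def)
  finally show ?thesis .
qed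

text \<open>Signal and error are each normal but possibly dependent, so they are separated by a
  crude bound with factor \<open>2 ^ 8 = 256\<close>. Multiplying by the eighth normal moment 105
  gives 26880.\<close>

lemma expectation_Y_pow8:
  assumes i: "i < n"
  shows "expectation (\<lambda>\<omega>. Y i \<omega> ^ 8) \<le> 26880 * (\<tau>2 + \<sigma>\<^sup>2) ^ 4"
proof -
  note m = has_moments_signal[OF i] has_moments_error[OF i] has_moments_Y[OF i]
  have le: "(a + b) ^ 8 \<le> 256 * (a ^ 8 + b ^ 8)" for a b :: real
  proof -
    have "(a + b) ^ 8 = \<bar>a + b\<bar> ^ 8" by simp
    also have "\<dots> \<le> (2 * max \<bar>a\<bar> \<bar>b\<bar>) ^ 8" by (rule power_mono) auto
    also have "\<dots> \<le> 256 * (a ^ 8 + b ^ 8)" by (auto simp: power_mult_distrib max_def)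
    finally show ?thesis .
  qed
  have "expectation (\<lambda>\<omega>. Y i \<omega> ^ 8) \<le> expectation (\<lambda>\<omega>. 256 * (signal i \<omega> ^ 8 + \<epsilon> i \<omega> ^ 8))"
  proof (rule integral_mono)
    show "Y i \<omega> ^ 8 \<le> 256 * (signal i \<omega> ^ 8 + \<epsilon> i \<omega> ^ 8)" if "\<omega> \<in> space M" for \<omega>
      unfolding response'[OF i that] by (rule le)
  qed (intro has_momentsD(4) has_moments_intros m)+
  also have "\<dots> = 256 * (expectation (\<lambda>\<omega>. signal i \<omega> ^ 8) + expectation (\<lambda>\<omega>. \<epsilon> i \<omega> ^ 8))"
    by (simp add: has_momentsD m)
  also have "expectation (\<lambda>\<omega>. signal i \<omega> ^ 8) = 105 * \<tau>2 ^ 4"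
    unfolding signal_def by (rule iid_std_normal.linear_moments(2)[OF row_iid[OF i]])
  also have "expectation (\<lambda>\<omega>. \<epsilon> i \<omega> ^ 8) = 105 * (\<sigma>\<^sup>2) ^ 4"
    using error_moments(2)[OF i i, of 4] by (simp add: fact_numeral flip: power_mult)
  also have "256 * (105 * \<tau>2 ^ 4 + 105 * (\<sigma>\<^sup>2) ^ 4) \<le> 26880 * (\<tau>2 + \<sigma>\<^sup>2) ^ 4"
  proof -
    have "a ^ 4 + b ^ 4 \<le> (a + b) ^ 4" if "0 \<le> a" "0 \<le> b" for a b :: real
    proof -
      have "(a + b) ^ 4 = a ^ 4 + b ^ 4 + (4 * a ^ 3 * b + 6 * a\<^sup>2 * b\<^sup>2 + 4 * a * b ^ 3)" by algebra
      then show ?thesis using that by simp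
    qed
    from this[of \<tau>2 "\<sigma>\<^sup>2"] show ?thesis by (simp add: sum_nonneg)
  qed
  finally show ?thesis .
qed

text \<open>
  The errors need not be independent of the covariates, so \<open>Y\<^sup>4\<close> and \<open>excess\<^sup>2\<close> are
  separated by AM-GM, at the price of an eighth moment of \<open>Y\<close>.
\<close>

lemma expectation_Y_sq_excess_sq:
  assumes i: "i < n"
  shows "expectation (\<lambda>\<omega>. ((Y i \<omega>)\<^sup>2 * excess i \<omega>)\<^sup>2) \<le> real p * (13440 * (\<tau>2 + \<sigma>\<^sup>2) ^ 4 + 30)"
proof -
  note m = has_moments_excess[OF i] has_moments_Y[OF i]
  \<comment> \<open>The weight \<open>p\<close> balances the two halves: \<open>excess\<close> has a
    fourth moment of order \<open>p\<^sup>2\<close>, so after division by \<open>p\<close> both are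
    of order \<open>p\<close>.\<close>
  have le: "(y\<^sup>2 * q)\<^sup>2 \<le> (real p * y ^ 8 + q ^ 4 / real p) / 2" if "0 < p" for y q :: real
  proof -
    have "0 \<le> (sqrt p * y ^ 4 - q\<^sup>2 / sqrt p)\<^sup>2" by simp
    also have "\<dots> = real p * y ^ 8 + q ^ 4 / real p - 2 * (y\<^sup>2 * q)\<^sup>2"
      using that by (simp add: power2_diff power_mult_distrib power_divide flip: power_mult)
    finally show ?thesis by simp
  qed
  show ?thesis
  proof (cases "p = 0")
    case True
    then show ?thesis unfolding excess_def by simp
  next
    case False
    have "expectation (\<lambda>\<omega>. ((Y i \<omega>)\<^sup>2 * excess i \<omega>)\<^sup>2) \<le>
       expectation (\<lambda>\<omega>. (real p * Y i \<omega> ^ 8 + excess i \<omega> ^ 4 * (1 / real p)) * (1 / 2))"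
    proof (rule integral_mono)
      show "((Y i \<omega>)\<^sup>2 * excess i \<omega>)\<^sup>2 \<le>
          (real p * Y i \<omega> ^ 8 + excess i \<omega> ^ 4 * (1 / real p)) * (1 / 2)" for \<omega>
        using le[of "Y i \<omega>" "excess i \<omega>"] False by simp
    qed (intro has_momentsD(4) has_moments_intros m)+
    also have "\<dots> = (real p * expectation (\<lambda>\<omega>. Y i \<omega> ^ 8) + expectation (\<lambda>\<omega>. excess i \<omega> ^ 4) / real p) / 2"
      by (simp add: has_momentsD m)
    also have "\<dots> \<le> (real p * (26880 * (\<tau>2 + \<sigma>\<^sup>2) ^ 4) + (60 * (real p)\<^sup>2) / real p) / 2"
      using iid_std_normal.chisq_fourth_moment[OF row_iid[OF i]] expectation_Y_pow8[OF i]
      by (intro divide_right_mono add_mono mult_left_mono) (auto simp: excess_def)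
    also have "\<dots> = real p * (13440 * (\<tau>2 + \<sigma>\<^sup>2) ^ 4 + 30)"
      using False by (simp add: power2_eq_square algebra_simps)
    finally show ?thesis .
  qed
qed

section \<open>Moment bounds for the diagonal and off-diagonal sums\<close>

lemma has_moments_W:
  "i < n \<Longrightarrow> j < p \<Longrightarrow> has_moments M (\<lambda>\<omega>. W (\<lambda>i. X i \<omega>) (\<lambda>i. Y i \<omega>) i j)"
  unfolding W_def by (intro has_moments_mult has_moments_X has_moments_Y)

lemma second_moment_diagonal:
  defines "D \<equiv> \<lambda>\<omega>. \<Sum>i<n. (Y i \<omega>)\<^sup>2 * excess i \<omega>"
  shows "expectation (\<lambda>\<omega>. (D \<omega>)\<^sup>2) \<le>
    real n * (real p * (13440 * (\<tau>2 + \<sigma>\<^sup>2) ^ 4 + 30)) + 4 * (real n)\<^sup>2 * \<tau>2\<^sup>2"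
proof -
  \<comment> \<open>Independence is available only for whole observations, so each summand is
    written as a function of its pair.\<close>
  have "indep_vars (\<lambda>_. borel) (\<lambda>i \<omega>. (\<lambda>(x, y). y\<^sup>2 * (\<Sum>j<p. (x j)\<^sup>2 - 1)) (X i \<omega>, Y i \<omega>)) {..<n}"
    by (rule indep_vars_compose2[OF indep_pairs]) measurable
  then have "indep_vars (\<lambda>_. borel) (\<lambda>i \<omega>. (Y i \<omega>)\<^sup>2 * excess i \<omega>) {..<n}"
    by (simp add: excess_def)
  from indep_sum_second_moment[OF this, of "2 * \<tau>2"]
  have "expectation (\<lambda>\<omega>. (D \<omega>)\<^sup>2) \<le>
      (\<Sum>i<n. expectation (\<lambda>\<omega>. ((Y i \<omega>)\<^sup>2 * excess i \<omega>)\<^sup>2)) + (real n)\<^sup>2 * (2 * \<tau>2)\<^sup>2"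
    unfolding D_def using expectation_Y_sq_excess
    by (simp add: has_moments_intros has_moments_excess has_moments_Y)
  also have "\<dots> \<le> (\<Sum>i<n. real p * (13440 * (\<tau>2 + \<sigma>\<^sup>2) ^ 4 + 30)) + (real n)\<^sup>2 * (2 * \<tau>2)\<^sup>2"
    by (intro add_right_mono sum_mono expectation_Y_sq_excess_sq) auto
  finally show ?thesis by (simp add: power2_eq_square algebra_simps)
qed

text \<open>\<open>S\<close> is the difference of the nonnegative \<open>V\<close>, the squared norm
  of the column sums, and \<open>T\<close>, the sum of all squared entries. Hence
  \<open>\<bar>S\<bar> \<le> V + T\<close>, and \<open>V\<close> costs at most another
  \<open>T\<close> plus the squared means in expectation.\<close>

lemma first_moment_offdiagonal:
  defines "S \<equiv> \<lambda>\<omega>. \<Sum>j<p. \<Sum>i\<^sub>1<n. \<Sum>i\<^sub>2\<in>{..<n} - {i\<^sub>1}.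
      W (\<lambda>i. X i \<omega>) (\<lambda>i. Y i \<omega>) i\<^sub>1 j * W (\<lambda>i. X i \<omega>) (\<lambda>i. Y i \<omega>) i\<^sub>2 j"
  shows "expectation (\<lambda>\<omega>. \<bar>S \<omega>\<bar>) \<le>
    2 * real n * (2 * \<tau>2 + real p * (\<tau>2 + \<sigma>\<^sup>2)) + (real n)\<^sup>2 * \<tau>2"
proof -
  define w where "w i j \<omega> = W (\<lambda>i. X i \<omega>) (\<lambda>i. Y i \<omega>) i j" for i j \<omega>
  define V where "V \<omega> = (\<Sum>j<p. (\<Sum>i<n. w i j \<omega>)\<^sup>2)" for \<omega>
  define T where "T \<omega> = (\<Sum>j<p. \<Sum>i<n. (w i j \<omega>)\<^sup>2)" for \<omega>
  have w: "has_moments M (w i j)" if "i < n" "j < p" for i j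
    unfolding w_def using that by (rule has_moments_W)
  have mV: "has_moments M V" unfolding V_def by (intro has_moments_intros w) auto
  have mT: "has_moments M T" unfolding T_def by (intro has_moments_intros w) auto
  have S: "S \<omega> = V \<omega> - T \<omega>" for \<omega>
    unfolding S_def V_def T_def w_def[symmetric] sum_subtractf[symmetric]
    by (intro sum.cong)
      (simp_all add: power2_eq_square sum_product sum_subtractf sum_diff1 flip: sum_subtractf)
  have ET: "expectation T = real n * (2 * \<tau>2 + real p * (\<tau>2 + \<sigma>\<^sup>2))"
  proof -
    \<comment> \<open>The squared norm of row \<open>i\<close> is split as \<open>excess\<close>
      plus \<open>p\<close>, whose weighted means are already known.\<close>
    have "(\<Sum>j<p. (w i j \<omega>)\<^sup>2) = (Y i \<omega>)\<^sup>2 * excess i \<omega> + real p * (Y i \<omega>)\<^sup>2" for i \<omega>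
      unfolding w_def W_def excess_def
      by (simp add: power_mult_distrib sum_subtractf algebra_simps flip: sum_distrib_left)
    then have "T \<omega> = (\<Sum>i<n. (Y i \<omega>)\<^sup>2 * excess i \<omega> + real p * (Y i \<omega>)\<^sup>2)" for \<omega>
      unfolding T_def by (subst sum.swap) simp
    then have "expectation T = expectation (\<lambda>\<omega>. \<Sum>i<n. (Y i \<omega>)\<^sup>2 * excess i \<omega> + real p * (Y i \<omega>)\<^sup>2)"
      by presburger
    also have "\<dots> = (\<Sum>i<n. expectation (\<lambda>\<omega>. (Y i \<omega>)\<^sup>2 * excess i \<omega> + real p * (Y i \<omega>)\<^sup>2))"
      by (intro Bochner_Integration.integral_sum has_momentsD(4) has_moments_intros
          has_moments_Y has_moments_excess) auto
    also have "\<dots> = (\<Sum>i<n. 2 * \<tau>2 + real p * (\<tau>2 + \<sigma>\<^sup>2))"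
      by (intro sum.cong) (simp_all add: has_momentsD has_moments_intros has_moments_Y
          has_moments_excess expectation_Y_sq expectation_Y_sq_excess)
    finally show ?thesis by simp
  qed
  have EV: "expectation V \<le> expectation T + (real n)\<^sup>2 * \<tau>2"
  proof -
    have "indep_vars (\<lambda>_. borel) (\<lambda>i \<omega>. (\<lambda>(x, y). x j * y) (X i \<omega>, Y i \<omega>)) {..<n}" if "j < p" for j
      by (rule indep_vars_compose2[OF indep_pairs]) (use that in measurable)
    then have "indep_vars (\<lambda>_. borel) (\<lambda>i. w i j) {..<n}" if "j < p" for j
      using that by (simp add: w_def[abs_def] W_def)
    \<comment> \<open>Within column \<open>j\<close> the entries are independent with mean
      \<open>\<beta> j\<close>; summing the squared means over the columns gives
      \<open>\<tau>2\<close>.\<close>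
    then have *: "expectation (\<lambda>\<omega>. (\<Sum>i<n. w i j \<omega>)\<^sup>2) \<le>
        (\<Sum>i<n. expectation (\<lambda>\<omega>. (w i j \<omega>)\<^sup>2)) + (real n)\<^sup>2 * (\<beta> j)\<^sup>2" if "j < p" for j
      by (rule indep_sum_second_moment)
        (use that w in \<open>auto simp: w_def[abs_def] expectation_W\<close>)
    have "expectation V = (\<Sum>j<p. expectation (\<lambda>\<omega>. (\<Sum>i<n. w i j \<omega>)\<^sup>2))"
      unfolding V_def
      by (intro Bochner_Integration.integral_sum has_momentsD(4) has_moments_intros w) auto
    also have "\<dots> \<le> (\<Sum>j<p. (\<Sum>i<n. expectation (\<lambda>\<omega>. (w i j \<omega>)\<^sup>2)) + (real n)\<^sup>2 * (\<beta> j)\<^sup>2)"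
      by (intro sum_mono *) auto
    also have "\<dots> = (\<Sum>j<p. \<Sum>i<n. expectation (\<lambda>\<omega>. (w i j \<omega>)\<^sup>2)) + (real n)\<^sup>2 * \<tau>2"
      by (simp add: sum.distrib sum_distrib_left)
    also have "(\<Sum>j<p. \<Sum>i<n. expectation (\<lambda>\<omega>. (w i j \<omega>)\<^sup>2)) =
        (\<Sum>j<p. expectation (\<lambda>\<omega>. \<Sum>i<n. (w i j \<omega>)\<^sup>2))"
      by (intro sum.cong refl Bochner_Integration.integral_sum[symmetric] has_momentsD(4)
          has_moments_intros w) auto
    also have "\<dots> = expectation T"
      unfolding T_def
      by (intro Bochner_Integration.integral_sum[symmetric] has_momentsD(4) has_moments_intros w) auto
    finally show ?thesis .
  qed
  have "\<bar>S \<omega>\<bar> \<le> V \<omega> + T \<omega>" for \<omega>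
  proof -
    have "0 \<le> V \<omega>" "0 \<le> T \<omega>" unfolding V_def T_def by (auto intro!: sum_nonneg)
    then show ?thesis unfolding S by linarith
  qed
  then have "expectation (\<lambda>\<omega>. \<bar>S \<omega>\<bar>) \<le> expectation (\<lambda>\<omega>. V \<omega> + T \<omega>)"
    using mV mT unfolding S
    by (intro integral_mono) (auto intro!: has_momentsD(4) has_moments_intros integrable_abs)
  also have "\<dots> = expectation V + expectation T"
    by (simp add: has_momentsD mV mT)
  finally show ?thesis using EV unfolding ET by (simp add: algebra_simps)
qed

end

subsection \<open>Comparison of the two estimators\<close>

text \<open>The coefficient of \<open>S\<close> is
  \<open>1 / (n (n - 1)) - 1 / (n (n + 1)) = 2 / (n (n - 1) (n + 1))\<close>, one order smaller in
  \<open>n\<close> than either normalization. The bound \<open>2 \<le> n\<close> keeps the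
  denominators nonzero.\<close>

lemma naive_minus_dicker:
  fixes x :: "nat \<Rightarrow> nat \<Rightarrow> real" and y :: "nat \<Rightarrow> real" and n p :: nat
  assumes n: "2 \<le> n"
  defines "S \<equiv> \<Sum>j<p. \<Sum>i\<^sub>1<n. \<Sum>i\<^sub>2\<in>{..<n} - {i\<^sub>1}. W x y i\<^sub>1 j * W x y i\<^sub>2 j"
    and "D \<equiv> \<Sum>i<n. (y i)\<^sup>2 * (\<Sum>j<p. (x i j)\<^sup>2 - 1)"
  shows "naive_estimator n p x y - dicker_estimator n p x y =
    2 * S / (real n * (real n - 1) * (real n + 1)) - D / (real n * (real n + 1))"
proof -
  have "(\<Sum>i<n. W x y i j)\<^sup>2 = (\<Sum>i\<^sub>1<n. \<Sum>i\<^sub>2\<in>{..<n} - {i\<^sub>1}. W x y i\<^sub>1 j * W x y i\<^sub>2 j)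
      + (\<Sum>i<n. (W x y i j)\<^sup>2)" for j
    unfolding power2_eq_square sum_product sum.distrib[symmetric]
    by (intro sum.cong refl) (simp add: sum_diff1)
  then have V: "sq_norm p (\<lambda>j. \<Sum>i<n. x i j * y i) = S + (\<Sum>j<p. \<Sum>i<n. (W x y i j)\<^sup>2)"
    unfolding sq_norm_def S_def by (simp add: W_def sum.distrib)
  have "(\<Sum>j<p. \<Sum>i<n. (W x y i j)\<^sup>2) = D + real p * sq_norm n y"
    unfolding D_def sq_norm_def W_def
    by (subst sum.swap)
      (simp add: power_mult_distrib sum_subtractf algebra_simps sum_distrib_left sum.distrib)
  with V have "dicker_estimator n p x y = (S + D) / (real n * (real n + 1))"
    by (simp add: dicker_estimator_def)
  moreover have "naive_estimator n p x y = S / (real n * (real n - 1))"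
    by (simp add: naive_estimator_def S_def)
  moreover have "S / (m * (m - 1)) - (S + D) / (m * (m + 1)) =
      2 * S / (m * (m - 1) * (m + 1)) - D / (m * (m + 1))" if "2 \<le> m" for m :: real
  proof -
    have "m \<noteq> 0" "m - 1 \<noteq> 0" "m + 1 \<noteq> 0" using that by auto
    then show ?thesis by (simp add: divide_simps) (simp add: algebra_simps)
  qed
  ultimately show ?thesis using n by simp
qed

text \<open>This is the pointwise form of Markov's inequality for \<open>S\<close> and Chebyshev's
  for \<open>D\<close>: one of the two parts must reach \<open>\<delta> / 2\<close>. Integrating it
  bounds the tail without a union of events.\<close>

lemma tail_indicator_bound:
  fixes S D \<delta> :: real and n :: nat
  assumes n: "2 \<le> n" and \<delta>: "0 < \<delta>"
    and large: "\<delta> < \<bar>sqrt n * (2 * S / (real n * (real n - 1) * (real n + 1)) - D / (real n * (real n + 1)))\<bar>"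
  shows "1 \<le> 8 / (\<delta> * (real n)\<^sup>2 * sqrt n) * \<bar>S\<bar> + 4 / (\<delta>\<^sup>2 * real n ^ 3) * D\<^sup>2"
proof -
  define U where "U = sqrt n * (2 * S / (real n * (real n - 1) * (real n + 1)))"
  define V where "V = sqrt n * (D / (real n * (real n + 1)))"
  have s: "sqrt n * sqrt n = real n" "0 < sqrt n" using n by auto
  have U: "\<bar>U\<bar> \<le> 4 / ((real n)\<^sup>2 * sqrt n) * \<bar>S\<bar>"
  proof -
    have "(real n)\<^sup>2 * sqrt n * sqrt n * 2 \<le> 4 * (real n * (real n - 1) * (real n + 1))"
    proof -
      \<comment> \<open>For \<open>n \<ge> 2\<close> the factor \<open>n - 1\<close> is at least
        \<open>n / 2\<close>, which turns the coefficient 2 into 4.\<close>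
      have "real n * (real n / 2) * real n \<le> real n * (real n - 1) * (real n + 1)"
        using n by (intro mult_mono) auto
      then show ?thesis using s by (simp add: power2_eq_square mult.assoc) (simp add: algebra_simps)
    qed
    then have "sqrt n * 2 / (real n * (real n - 1) * (real n + 1)) \<le> 4 / ((real n)\<^sup>2 * sqrt n)"
      using n by (simp add: divide_simps mult_ac)
    from mult_right_mono[OF this, of "\<bar>S\<bar>"] show ?thesis
      using n by (simp add: U_def abs_mult)
  qed
  have V: "V\<^sup>2 \<le> 1 / real n ^ 3 * D\<^sup>2"
  proof -
    have "V\<^sup>2 = real n / (real n * (real n + 1))\<^sup>2 * D\<^sup>2"
      by (simp add: V_def power_mult_distrib power_divide)
    also have "real n / (real n * (real n + 1))\<^sup>2 \<le> real n / (real n * real n)\<^sup>2"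
      using n by (intro divide_left_mono power_mono mult_left_mono) auto
    also have "\<dots> = 1 / real n ^ 3"
      using n by (simp add: field_simps eval_nat_numeral)
    finally show ?thesis by (simp add: mult_right_mono)
  qed
  have "\<delta> < \<bar>U\<bar> + \<bar>V\<bar>" using large unfolding U_def V_def right_diff_distrib by linarith
  then consider "\<delta> / 2 \<le> \<bar>U\<bar>" | "\<delta> / 2 \<le> \<bar>V\<bar>" by linarith
  then have "1 \<le> 2 / \<delta> * \<bar>U\<bar> + 4 / \<delta>\<^sup>2 * V\<^sup>2"
  proof cases
    case 1
    then have "1 \<le> 2 / \<delta> * \<bar>U\<bar>" using \<delta> by (simp add: field_simps)
    moreover have "0 \<le> 4 / \<delta>\<^sup>2 * V\<^sup>2" by simp
    ultimately show ?thesis by linarith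
  next
    case 2
    then have "(\<delta> / 2)\<^sup>2 \<le> V\<^sup>2" using \<delta> by (simp add: abs_le_square_iff[symmetric])
    then have "1 \<le> 4 / \<delta>\<^sup>2 * V\<^sup>2" using \<delta> by (simp add: field_simps power2_eq_square)
    moreover have "0 \<le> 2 / \<delta> * \<bar>U\<bar>" using \<delta> by simp
    ultimately show ?thesis by linarith
  qed
  also have "\<dots> \<le> 2 / \<delta> * (4 / ((real n)\<^sup>2 * sqrt n) * \<bar>S\<bar>) + 4 / \<delta>\<^sup>2 * (1 / real n ^ 3 * D\<^sup>2)"
    using U V \<delta> by (intro add_mono mult_left_mono) auto
  finally show ?thesis by (simp add: mult_ac)
qed

text \<open>The bound depends on \<open>p\<close> only through \<open>p / n\<close> and on the
  parameters only through \<open>B\<close>. With both bounded, its two terms decay like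
  \<open>1 / sqrt n\<close> and \<open>1 / n\<close>.\<close>

lemma (in gaussian_linear_model) tail_bound:
  assumes n: "2 \<le> n" and \<delta>: "0 < \<delta>" and B: "\<tau>2 + \<sigma>\<^sup>2 \<le> B"
  shows "measure M {\<omega> \<in> space M. \<delta> < \<bar>sqrt n * (naive_estimator n p (\<lambda>i. X i \<omega>) (\<lambda>i. Y i \<omega>)
      - dicker_estimator n p (\<lambda>i. X i \<omega>) (\<lambda>i. Y i \<omega>))\<bar>} \<le>
    8 * B / \<delta> * (4 / real n + 2 * (real p / real n) + 1) / sqrt n
    + 4 / \<delta>\<^sup>2 * (real p / real n * (13440 * B ^ 4 + 30) + 4 * B\<^sup>2) / real n"
    (is "measure M ?A \<le> _")
proof -
  define S where "S \<omega> = (\<Sum>j<p. \<Sum>i\<^sub>1<n. \<Sum>i\<^sub>2\<in>{..<n} - {i\<^sub>1}.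
      W (\<lambda>i. X i \<omega>) (\<lambda>i. Y i \<omega>) i\<^sub>1 j * W (\<lambda>i. X i \<omega>) (\<lambda>i. Y i \<omega>) i\<^sub>2 j)" for \<omega>
  define D where "D \<omega> = (\<Sum>i<n. (Y i \<omega>)\<^sup>2 * excess i \<omega>)" for \<omega>
  define a where "a = 8 / (\<delta> * (real n)\<^sup>2 * sqrt n)"
  define b where "b = 4 / (\<delta>\<^sup>2 * real n ^ 3)"
  have [simp]: "0 \<le> a" "0 \<le> b" using \<delta> by (auto simp: a_def b_def)
  have mS: "has_moments M S" unfolding S_def by (intro has_moments_intros has_moments_W) auto
  have mD: "has_moments M D"
    unfolding D_def by (intro has_moments_intros has_moments_Y has_moments_excess) auto
  have A: "?A = {\<omega> \<in> space M. \<delta> < \<bar>sqrt n * (2 * S \<omega> / (real n * (real n - 1) * (real n + 1))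
      - D \<omega> / (real n * (real n + 1)))\<bar>}"
    by (simp add: naive_minus_dicker[OF n] S_def D_def excess_def)
  have [measurable]: "S \<in> borel_measurable M" "D \<in> borel_measurable M"
    using mS mD by (auto dest: has_momentsD)
  have [measurable]: "?A \<in> sets M" unfolding A by measurable
  have \<tau>: "0 \<le> \<tau>2" "\<tau>2 \<le> B" "0 \<le> B" using B by (auto simp: sum_nonneg intro: order_trans[rotated])
  have "measure M ?A = expectation (indicator ?A)" by simp
  also have "\<dots> \<le> expectation (\<lambda>\<omega>. a * \<bar>S \<omega>\<bar> + b * (D \<omega>)\<^sup>2)"
  proof (rule integral_mono)
    show "integrable M (indicator ?A :: 'a \<Rightarrow> real)" by (simp add: integrable_indicator_iff emeasure_finite less_top[symmetric])
    show "integrable M (\<lambda>\<omega>. a * \<bar>S \<omega>\<bar> + b * (D \<omega>)\<^sup>2)"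
      using has_momentsD(3)[OF mS, of 1] by (simp add: has_momentsD mD)
    fix \<omega> assume "\<omega> \<in> space M"
    show "indicator ?A \<omega> \<le> a * \<bar>S \<omega>\<bar> + b * (D \<omega>)\<^sup>2"
    proof (cases "\<omega> \<in> ?A")
      case True
      then have "1 \<le> a * \<bar>S \<omega>\<bar> + b * (D \<omega>)\<^sup>2"
        unfolding A a_def b_def by (intro tail_indicator_bound[OF n \<delta>]) auto
      then show ?thesis using True by simp
    qed simp
  qed
  also have "\<dots> = a * expectation (\<lambda>\<omega>. \<bar>S \<omega>\<bar>) + b * expectation (\<lambda>\<omega>. (D \<omega>)\<^sup>2)"
    using has_momentsD(3)[OF mS, of 1] by (simp add: has_momentsD mD)
  \<comment> \<open>Both moment bounds increase in \<open>\<tau>2\<close> and in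
    \<open>\<tau>2 + \<sigma>\<^sup>2\<close>, so these are replaced by \<open>B\<close>.\<close>
  also have "\<dots> \<le> a * (2 * real n * (2 * B + real p * B) + (real n)\<^sup>2 * B)
      + b * (real n * (real p * (13440 * B ^ 4 + 30)) + 4 * (real n)\<^sup>2 * B\<^sup>2)"
  proof (intro add_mono mult_left_mono)
    show "expectation (\<lambda>\<omega>. \<bar>S \<omega>\<bar>) \<le> 2 * real n * (2 * B + real p * B) + (real n)\<^sup>2 * B"
      unfolding S_def
      by (rule order_trans[OF first_moment_offdiagonal])
        (use \<tau> B in \<open>intro add_mono mult_left_mono; simp\<close>)
    show "expectation (\<lambda>\<omega>. (D \<omega>)\<^sup>2) \<le>
        real n * (real p * (13440 * B ^ 4 + 30)) + 4 * (real n)\<^sup>2 * B\<^sup>2"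
      unfolding D_def
      by (rule order_trans[OF second_moment_diagonal])
        (use \<tau> B in \<open>intro add_mono mult_left_mono power_mono; simp\<close>)
  qed auto
  also have "a * (2 * real n * (2 * B + real p * B) + (real n)\<^sup>2 * B) =
      8 * B / \<delta> * (4 / real n + 2 * (real p / real n) + 1) / sqrt n"
    using n \<delta> by (simp add: a_def field_simps power2_eq_square)
  also have "b * (real n * (real p * (13440 * B ^ 4 + 30)) + 4 * (real n)\<^sup>2 * B\<^sup>2) =
      4 / \<delta>\<^sup>2 * (real p / real n * (13440 * B ^ 4 + 30) + 4 * B\<^sup>2) / real n"
    using n \<delta> by (simp add: b_def field_simps eval_nat_numeral)
  finally show ?thesis .
qed

theorem lemma1:
  fixes M :: "nat \<Rightarrow> 'a measure"
    and p :: "nat \<Rightarrow> nat" and \<beta> :: "nat \<Rightarrow> nat \<Rightarrow> real" and \<sigma> :: "nat \<Rightarrow> real"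
    and X :: "nat \<Rightarrow> nat \<Rightarrow> 'a \<Rightarrow> nat \<Rightarrow> real" and Y \<epsilon> :: "nat \<Rightarrow> nat \<Rightarrow> 'a \<Rightarrow> real"
    and \<tau>sq :: "nat \<Rightarrow> real" and c :: real
  assumes model: "\<And>n. gaussian_linear_model (M n) n (p n) (\<beta> n) (\<sigma> n) (X n) (Y n) (\<epsilon> n)"
    and tau: "\<And>n. \<tau>sq n = sq_norm (p n) (\<beta> n)"
    and p_infinity: "filterlim p at_top sequentially"
    and bounded: "Bseq (\<lambda>n. \<tau>sq n + (\<sigma> n)\<^sup>2)"
    and ratio: "(\<lambda>n. real (p n) / real n) \<longlonglongrightarrow> c"
  shows "tendsto_in_prob M
           (\<lambda>n \<omega>. sqrt (real n) *
              (naive_estimator n (p n) (\<lambda>i. X n i \<omega>) (\<lambda>i. Y n i \<omega>)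
               - dicker_estimator n (p n) (\<lambda>i. X n i \<omega>) (\<lambda>i. Y n i \<omega>)))
           0"
  unfolding tendsto_in_prob_def
proof (intro allI impI)
  fix \<delta> :: real assume \<delta>: "0 < \<delta>"
  obtain B where B: "\<And>n. norm (\<tau>sq n + (\<sigma> n)\<^sup>2) \<le> B"
    using BseqE[OF bounded] by blast
  have le: "(\<Sum>j<p n. (\<beta> n j)\<^sup>2) + (\<sigma> n)\<^sup>2 \<le> B" for n
    using B[of n] by (simp add: tau sq_norm_def)
  let ?Z = "\<lambda>n \<omega>. sqrt (real n) *
              (naive_estimator n (p n) (\<lambda>i. X n i \<omega>) (\<lambda>i. Y n i \<omega>)
               - dicker_estimator n (p n) (\<lambda>i. X n i \<omega>) (\<lambda>i. Y n i \<omega>))"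
  let ?h = "\<lambda>n. 8 * B / \<delta> * (4 / real n + 2 * (real (p n) / real n) + 1) / sqrt n
    + 4 / \<delta>\<^sup>2 * (real (p n) / real n * (13440 * B ^ 4 + 30) + 4 * B\<^sup>2) / real n"
  have sqrt: "filterlim (\<lambda>n. sqrt (real n)) at_infinity sequentially"
    by (intro filterlim_at_top_imp_at_infinity filterlim_compose[OF sqrt_at_top]
        filterlim_real_sequentially)
  have real: "filterlim real at_infinity sequentially"
    by (intro filterlim_at_top_imp_at_infinity filterlim_real_sequentially)
  \<comment> \<open>Each numerator has a finite limit because \<open>p / n\<close> tends to
    \<open>c\<close>, while the denominators \<open>sqrt n\<close> and \<open>n\<close>
    diverge.\<close>
  have h: "?h \<longlonglongrightarrow> 0"
  proof (rule tendsto_add_zero)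
    have "(\<lambda>n. 8 * B / \<delta> * (4 / real n + 2 * (real (p n) / real n) + 1))
        \<longlonglongrightarrow> 8 * B / \<delta> * (0 + 2 * c + 1)"
      by (intro tendsto_intros ratio tendsto_divide_0[OF tendsto_const real])
    from tendsto_divide_0[OF this sqrt]
    show "(\<lambda>n. 8 * B / \<delta> * (4 / real n + 2 * (real (p n) / real n) + 1) / sqrt n) \<longlonglongrightarrow> 0" .
    have "(\<lambda>n. 4 / \<delta>\<^sup>2 * (real (p n) / real n * (13440 * B ^ 4 + 30) + 4 * B\<^sup>2))
        \<longlonglongrightarrow> 4 / \<delta>\<^sup>2 * (c * (13440 * B ^ 4 + 30) + 4 * B\<^sup>2)"
      by (intro tendsto_intros ratio)
    from tendsto_divide_0[OF this real]
    show "(\<lambda>n. 4 / \<delta>\<^sup>2 * (real (p n) / real n * (13440 * B ^ 4 + 30) + 4 * B\<^sup>2) / real n)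
        \<longlonglongrightarrow> 0" .
  qed
  \<comment> \<open>The estimate starts at \<open>n = 2\<close>; this suffices for squeezing the
    probabilities between 0 and \<open>?h\<close>.\<close>
  have "\<forall>\<^sub>F n in sequentially. measure (M n) {\<omega> \<in> space (M n). \<bar>?Z n \<omega> - 0\<bar> > \<delta>} \<le> ?h n"
    using eventually_ge_at_top[of 2]
    by eventually_elim (use gaussian_linear_model.tail_bound[OF model _ \<delta> le] in simp)
  then show "(\<lambda>n. measure (M n) {\<omega> \<in> space (M n). \<bar>?Z n \<omega> - 0\<bar> > \<delta>}) \<longlonglongrightarrow> 0"
    by (intro tendsto_sandwich[OF _ _ tendsto_const h]) auto
qed

end
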